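(* Let $T>0$, $\mu,a_0\in\mathbb{R}$, $\theta>0$, $\sigma>0$, and let $a=(a(t),t\in[0,T])$ be the Ornstein--Uhlenbeck process solving $da(t)=\theta(\mu-a(t))\,dt+\sigma\,dW(t)$, $a(0)=a_0$, where $W$ is a standard Brownian motion on a probability space $(\Omega,\mathcal{F},P)$. Let $u$ be the solution of the random advection equation $$u_t(x,t,\omega)+\big(a(t,\omega)\,u(x,t,\omega)\big)_x=0,\qquad u(x,0,\omega)=g(x),$$ with deterministic initial function $g$. Then the moments of the solution $u$ exist and are given by $$\mathbb{E}(u(x,t))=\int g(x-y)\,f_{A(\hat\sigma^2,\,t\hat\mu)}(y)\,dy=\big(f_{A(\hat\sigma^2,0)}*g\big)(x-t\hat\mu),$$ where $g(x)=u(x,0)$ and the probability density function $f_A$ is given, for variance $s^2$ and mean $m$, by $$f_{A(s^2,m)}(y)=\frac{1}{\sqrt{2\pi s^2}}\,e^{-\frac{(y-m)^2}{2s^2}},$$ with diffusion coefficient $$\hat\sigma^2=\frac{\sigma^2}{\theta^3}\Big(\theta t+2e^{-\theta t}-\tfrac12 e^{-2\theta t}-\tfrac32\Big)$$ and transportation speed $$\hat\mu=\mu-(a_0-\mu)\frac{e^{-\theta t}-1}{\theta t}.$$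
   Context: The equation is a linear advection equation in one space dimension with a time-dependent stochastic velocity. A solution is a random function $u$ for which the equation holds for $P$-almost every $\omega\in\Omega$; for a single realization $\omega$ it is given by $u(x,t,\omega)=g\big(x-\int_0^t a(s,\omega)\,ds\big)$, $x\in\mathbb{R}$, $t\in(0,T]$. $\mathbb{E}$ denotes expectation with respect to $P$, integrals are over $\mathbb{R}$, and $(f*g)(z)=\int f(y)\,g(z-y)\,dy$ denotes the convolution of two functions.
   Formalization: The initial function g is taken to be Borel, and the k-th moment of u(x,t) is shown to exist when g(x-y)^k is integrable against the Gaussian density; without such a condition moments need not exist, e.g. for g(x)=exp(x^4). *)

theory Defs
  imports "HOL-Probability.Probability"
begin

definition independent_increments :: "'a measure \<Rightarrow> (real \<Rightarrow> 'a \<Rightarrow> real) \<Rightarrow> bool" where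
  "independent_increments M W \<longleftrightarrow>
     (\<forall>(n::nat) (\<tau>::nat \<Rightarrow> real). 0 \<le> \<tau> 0 \<and> (\<forall>i<n. \<tau> i \<le> \<tau> (Suc i)) \<longrightarrow>
        prob_space.indep_vars M (\<lambda>_. borel) (\<lambda>i \<omega>. W (\<tau> (Suc i)) \<omega> - W (\<tau> i) \<omega>) {..<n})"

definition standard_brownian_motion :: "'a measure \<Rightarrow> (real \<Rightarrow> 'a \<Rightarrow> real) \<Rightarrow> bool" where
  "standard_brownian_motion M W \<longleftrightarrow>
     (\<forall>t\<ge>0. W t \<in> borel_measurable M) \<and>
     (AE \<omega> in M. W 0 \<omega> = 0) \<and>
     independent_increments M W \<and>
     (\<forall>s t. 0 \<le> s \<and> s < t \<longrightarrow>
        distributed M lborel (\<lambda>\<omega>. W t \<omega> - W s \<omega>) (\<lambda>x. ennreal (normal_density 0 (sqrt (t - s)) x))) \<and>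
     (AE \<omega> in M. continuous_on {0..} (\<lambda>t. W t \<omega>))"

text \<open>
  The equation \<open>da = \<theta> (\<mu> - a) dt + \<sigma> dW\<close>, \<open>a(0) = a\<^sub>0\<close>, in its integral form, for a process with
  continuous paths on \<open>[0,T]\<close>. As the diffusion coefficient \<open>\<sigma>\<close> is constant, its Ito integral over
  \<open>[0,t]\<close> is \<open>\<sigma> (W(t) - W(0))\<close>, and the drift integral is a pathwise integral of a continuous function.
\<close>
definition ornstein_uhlenbeck ::
  "'a measure \<Rightarrow> (real \<Rightarrow> 'a \<Rightarrow> real) \<Rightarrow> real \<Rightarrow> real \<Rightarrow> real \<Rightarrow> real \<Rightarrow> real \<Rightarrow> (real \<Rightarrow> 'a \<Rightarrow> real) \<Rightarrow> bool"
where
  "ornstein_uhlenbeck M W T \<theta> \<mu> \<sigma> a\<^sub>0 a \<longleftrightarrow>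
     (\<forall>t\<in>{0..T}. a t \<in> borel_measurable M) \<and>
     (AE \<omega> in M. continuous_on {0..T} (\<lambda>t. a t \<omega>) \<and>
        (\<forall>t\<in>{0..T}. a t \<omega> =
           a\<^sub>0 + integral {0..t} (\<lambda>s. \<theta> * (\<mu> - a s \<omega>)) + \<sigma> * (W t \<omega> - W 0 \<omega>)))"

text \<open>
  Solutions for one realization \<open>b\<close> of the velocity; the argument order is \<open>v x t\<close>. Total
  differentiability (implied by \<open>C\<^sup>1\<close>) is required because the mere existence of the two partial
  derivatives does not give the chain rule along characteristics.
\<close>
definition classical_advection_solution ::
  "real \<Rightarrow> (real \<Rightarrow> real) \<Rightarrow> (real \<Rightarrow> real) \<Rightarrow> (real \<Rightarrow> real \<Rightarrow> real) \<Rightarrow> bool" where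
  "classical_advection_solution T b g v \<longleftrightarrow>
     continuous_on (UNIV \<times> {0..T}) (\<lambda>(x, t). v x t) \<and>
     (\<forall>x. \<forall>t\<in>{0<..<T}.
        (\<lambda>(x, t). v x t) differentiable (at (x, t)) \<and>
        deriv (\<lambda>\<tau>. v x \<tau>) t + deriv (\<lambda>\<xi>. b t * v \<xi> t) x = 0) \<and>
     (\<forall>x. v x 0 = g x)"

definition transported_profile ::
  "real \<Rightarrow> (real \<Rightarrow> real) \<Rightarrow> (real \<Rightarrow> real) \<Rightarrow> (real \<Rightarrow> real \<Rightarrow> real) \<Rightarrow> bool" where
  "transported_profile T b g v \<longleftrightarrow>
     (\<forall>x. v x 0 = g x) \<and> (\<forall>x. \<forall>t\<in>{0<..T}. v x t = g (x - integral {0..t} b))"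

text \<open>
  If \<open>g\<close> is not differentiable, the equation cannot hold pointwise, and its solution is the profile
  \<open>g\<close> transported along the characteristics. Both cases are admitted.
\<close>
definition advection_solution ::
  "real \<Rightarrow> (real \<Rightarrow> real) \<Rightarrow> (real \<Rightarrow> real) \<Rightarrow> (real \<Rightarrow> real \<Rightarrow> real) \<Rightarrow> bool" where
  "advection_solution T b g v \<longleftrightarrow>
     classical_advection_solution T b g v \<or> transported_profile T b g v"

definition random_advection_solution ::
  "'a measure \<Rightarrow> real \<Rightarrow> (real \<Rightarrow> 'a \<Rightarrow> real) \<Rightarrow> (real \<Rightarrow> real) \<Rightarrow> (real \<Rightarrow> real \<Rightarrow> 'a \<Rightarrow> real) \<Rightarrow> bool" where
  "random_advection_solution M T a g u \<longleftrightarrow>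
     (\<forall>x. \<forall>t\<in>{0..T}. u x t \<in> borel_measurable M) \<and>
     (AE \<omega> in M. advection_solution T (\<lambda>t. a t \<omega>) g (\<lambda>x t. u x t \<omega>))"

text \<open>The first parameter is the variance, unlike in \<^const>\<open>normal_density\<close>.\<close>
definition gaussian_pdf :: "real \<Rightarrow> real \<Rightarrow> real \<Rightarrow> real" where
  "gaussian_pdf v m y = 1 / sqrt (2 * pi * v) * exp (- ((y - m)\<^sup>2) / (2 * v))"

definition fun_convolution :: "(real \<Rightarrow> real) \<Rightarrow> (real \<Rightarrow> real) \<Rightarrow> real \<Rightarrow> real" where
  "fun_convolution f g z = (\<integral>y. f y * g (z - y) \<partial>lborel)"

definition diffusion_coeff :: "real \<Rightarrow> real \<Rightarrow> real \<Rightarrow> real" where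
  "diffusion_coeff \<theta> \<sigma> t =
     \<sigma>\<^sup>2 / \<theta> ^ 3 * (\<theta> * t + 2 * exp (- \<theta> * t) - 1 / 2 * exp (- 2 * \<theta> * t) - 3 / 2)"

definition transport_speed :: "real \<Rightarrow> real \<Rightarrow> real \<Rightarrow> real \<Rightarrow> real" where
  "transport_speed \<theta> \<mu> a\<^sub>0 t = \<mu> - (a\<^sub>0 - \<mu>) * ((exp (- \<theta> * t) - 1) / (\<theta> * t))"

end

theory Submission imports Defs begin

text \<open>
  For almost every \<open>\<omega>\<close> the solution is the initial profile shifted by the integrated velocity,
  \<open>u x t = g (x - A)\<close> with \<open>A\<close> the integral of the path of \<open>a\<close> over \<open>[0, t]\<close>. For a profile transported by
  definition this is immediate, for a classical solution it holds because the solution is constant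
  along characteristics (\<open>classical_advection_solution_imp_transported\<close>). The moments of \<open>u x t\<close> are
  therefore integrals against the law of \<open>A\<close>, and the theorem amounts to the fact that \<open>A\<close> is normal
  with mean \<open>t * transport_speed \<theta> \<mu> a\<^sub>0 t\<close> and variance \<open>diffusion_coeff \<theta> \<sigma> t\<close>
  (\<open>integrated_ornstein_uhlenbeck_normal\<close>).

  The noise in the velocity equation is additive, so the equation can be solved path by path
  (\<open>ornstein_uhlenbeck_path_integral\<close>): \<open>A\<close> is its asserted mean plus the integral of
  \<open>\<sigma> * exp (- \<theta> * (t - s)) * (W s - W 0)\<close> over \<open>[0, t]\<close>. Integration by parts turns this into the Wiener
  integral of \<open>K s = \<sigma> * (1 - exp (- \<theta> * (t - s))) / \<theta>\<close> against \<open>W\<close>; concretely, the sums of \<open>K\<close> at the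
  left end points times the increments of \<open>W\<close> converge to it on every continuous path
  (\<open>wiener_sums_tendsto\<close>). These sums are combinations of independent centred normal variables, their
  variances converge to the integral of \<open>K\<^sup>2\<close>, which is \<open>diffusion_coeff \<theta> \<sigma> t\<close>, and comparison of
  characteristic functions gives the normal law of the limit (\<open>wiener_sums_limit_normal\<close>).
\<close>

section \<open>Transport along characteristics\<close>

text \<open>
  Along the characteristic \<open>X\<close> with \<open>X' = b\<close> that ends in \<open>(x, t)\<close> the equation says that
  \<open>s \<mapsto> v (X s) s\<close> has derivative zero, because \<open>b t\<close> does not depend on the space variable. The
  equation is assumed in the open time interval only; continuity of \<open>v\<close> up to the boundary covers the
  end points, including \<open>t = T\<close>.
\<close>
lemma classical_advection_solution_imp_transported:
  fixes b g :: "real \<Rightarrow> real"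
  assumes b: "continuous_on {0..T} b"
    and v: "classical_advection_solution T b g v"
    and t: "t \<in> {0<..T}"
  shows "v x t = g (x - integral {0..t} b)"
proof -
  define B where "B = (\<lambda>s. integral {0..s} b)"
  define X where "X = (\<lambda>s. x - B t + B s)"
  have cv: "continuous_on (UNIV \<times> {0..T}) (\<lambda>(x, t). v x t)"
    and v0: "\<And>x. v x 0 = g x"
    and pde: "\<And>x t. t \<in> {0<..<T} \<Longrightarrow> (\<lambda>(x, t). v x t) differentiable (at (x, t)) \<and>
        deriv (\<lambda>\<tau>. v x \<tau>) t + deriv (\<lambda>\<xi>. b t * v \<xi> t) x = 0"
    using v unfolding classical_advection_solution_def by auto
  have B': "(B has_real_derivative b s) (at s within {0..T})" if "s \<in> {0..T}" for s
    unfolding B_def using integral_has_real_derivative[OF b that] .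
  have contX: "continuous_on {0..t} X"
  proof -
    have "continuous_on {0..T} B"
      using B' by (meson DERIV_continuous_on)
    then show ?thesis
      unfolding X_def using t by (intro continuous_intros) (auto elim: continuous_on_subset)
  qed
  have cont: "continuous_on {0..t} (\<lambda>s. v (X s) s)"
  proof -
    have "continuous_on {0..t} (\<lambda>s. (\<lambda>(x, t). v x t) (X s, s))"
      by (rule continuous_on_compose2[OF cv]) (use t contX in \<open>auto intro!: continuous_intros\<close>)
    then show ?thesis by simp
  qed
  have der: "((\<lambda>s. v (X s) s) has_real_derivative 0) (at s)" if s: "0 < s" "s < t" for s
  proof -
    from s t have sT: "s \<in> {0<..<T}" by auto
    obtain D where D: "((\<lambda>(x, t). v x t) has_derivative D) (at (X s, s))"
      using pde[OF sT, of "X s"] unfolding differentiable_def by blast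
    interpret D: bounded_linear D using D by (rule has_derivative_bounded_linear)
    have D_split: "D (h, k) = h * D (1, 0) + k * D (0, 1)" for h k
    proof -
      have "D (h, k) = D (h *\<^sub>R (1, 0) + k *\<^sub>R (0, 1))" by simp
      also have "\<dots> = h *\<^sub>R D (1, 0) + k *\<^sub>R D (0, 1)" by (simp only: D.add D.scaleR)
      finally show ?thesis by simp
    qed
    \<comment> \<open>One chain rule serves for both partial derivatives and for the derivative along the characteristic.\<close>
    have chain: "((\<lambda>r. v (p r) (q r)) has_real_derivative D (p', q')) (at r)"
      if "(p has_real_derivative p') (at r)" "(q has_real_derivative q') (at r)" "p r = X s" "q r = s"
      for p q p' q' r
    proof -
      have "((\<lambda>r. (p r, q r)) has_derivative (\<lambda>h. (p' * h, q' * h))) (at r)"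
        using that(1,2) unfolding has_field_derivative_def by (rule has_derivative_Pair)
      moreover have "((\<lambda>(x, t). v x t) has_derivative D) (at (p r, q r))"
        using D that by simp
      ultimately have "((\<lambda>r. (\<lambda>(x, t). v x t) (p r, q r)) has_derivative (\<lambda>h. D (p' * h, q' * h))) (at r)"
        by (rule has_derivative_compose)
      moreover have "(\<lambda>h. D (p' * h, q' * h)) = (*) (D (p', q'))"
        by (rule ext, subst (1 2) D_split) (simp add: algebra_simps)
      ultimately show ?thesis unfolding has_field_derivative_def by simp
    qed
    have vt: "deriv (\<lambda>\<tau>. v (X s) \<tau>) s = D (0, 1)"
      by (rule DERIV_imp_deriv, rule chain) (auto intro!: derivative_eq_intros)
    have "((\<lambda>\<xi>. v \<xi> s) has_real_derivative D (1, 0)) (at (X s))"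
      by (rule chain) (auto intro!: derivative_eq_intros)
    then have vx: "deriv (\<lambda>\<xi>. b s * v \<xi> s) (X s) = b s * D (1, 0)"
      by (intro DERIV_imp_deriv DERIV_cmult)
    have "(B has_real_derivative b s) (at s)"
      using B'[of s] sT by (metis at_within_Icc_at atLeastAtMost_iff greaterThanLessThan_iff less_eq_real_def)
    then have "(X has_real_derivative b s) (at s)"
      unfolding X_def by (auto intro!: derivative_eq_intros)
    from chain[OF this DERIV_ident]
    have "((\<lambda>s. v (X s) s) has_real_derivative D (b s, 1)) (at s)" by simp
    moreover have "D (b s, 1) = 0"
      using pde[OF sT, of "X s"] vt vx D_split[of "b s" 1] by simp
    ultimately show ?thesis by simp
  qed
  have "v (X t) t = v (X 0) 0"
    using t by (intro DERIV_isconst_end cont der) auto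
  then show ?thesis by (simp add: X_def B_def v0)
qed

section \<open>Wiener integrals of deterministic kernels\<close>

text \<open>
  The tags \<open>\<xi>\<close> are arbitrary because the lemma is applied to right end points (the Wiener sums, after
  summation by parts) and to left end points (the variance of these sums).
\<close>
lemma riemann_stieltjes_sums_tendsto:
  fixes f G h :: "real \<Rightarrow> real"
  assumes t: "0 < t" and f: "continuous_on {0..t} f" and h: "continuous_on {0..t} h"
    and G: "\<And>s. s \<in> {0..t} \<Longrightarrow> (G has_real_derivative h s) (at s within {0..t})"
    and \<xi>: "\<And>n j. j < Suc n \<Longrightarrow> \<xi> n j \<in> {real j * (t / Suc n) .. real (Suc j) * (t / Suc n)}"
  shows "(\<lambda>n. \<Sum>j<Suc n. f (\<xi> n j) * (G (real (Suc j) * (t / Suc n)) - G (real j * (t / Suc n))))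
           \<longlonglongrightarrow> integral {0..t} (\<lambda>s. f s * h s)"
proof -
  \<comment> \<open>The points of the equidistant partition of \<open>[0, t]\<close> into \<open>n + 1\<close> intervals; writing \<open>n + 1\<close>
    avoids the division by zero at \<open>n = 0\<close>.\<close>
  define p where "p = (\<lambda>n j. real j * (t / Suc n))"
  have p0: "p n 0 = 0" and pn: "p n (Suc n) = t" for n by (simp_all add: p_def)
  have p_step: "p n (Suc j) = p n j + t / Suc n" for n j by (simp add: p_def algebra_simps add_divide_distrib)
  have p_mono: "p n i \<le> p n j" if "i \<le> j" for n i j
    unfolding p_def using that t by (intro mult_right_mono) auto
  have p_in: "0 \<le> p n j" "j \<le> Suc n \<Longrightarrow> p n j \<le> t" for n j
    using p_mono[of 0 j n] p_mono[of j "Suc n" n] p0 pn by auto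
  obtain C where C0: "0 < C" and C: "\<And>s. s \<in> {0..t} \<Longrightarrow> \<bar>h s\<bar> \<le> C"
  proof -
    have "bounded (h ` {0..t})" using h by (intro compact_imp_bounded compact_continuous_image) auto
    then obtain C where "\<forall>y\<in>h ` {0..t}. norm y \<le> C" unfolding bounded_iff by blast
    then show ?thesis by (intro that[of "max C 1"]) (auto simp: le_max_iff_disj)
  qed
  have fh: "continuous_on {0..t} (\<lambda>s. f s * h s)" using f h by (intro continuous_intros)
  have split: "integral {0..p n m} (\<lambda>s. f s * h s) = (\<Sum>j<m. integral {p n j..p n (Suc j)} (\<lambda>s. f s * h s))"
    if "m \<le> Suc n" for n m
    using that
  proof (induction m)
    case 0 then show ?case by (simp add: p0)
  next
    case (Suc m)
    have "integral {0..p n m} (\<lambda>s. f s * h s) + integral {p n m..p n (Suc m)} (\<lambda>s. f s * h s)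
        = integral {0..p n (Suc m)} (\<lambda>s. f s * h s)"
      using Suc.prems p_in[of n m] p_in[of "Suc m" n] p_mono[of m "Suc m" n]
      by (intro Henstock_Kurzweil_Integration.integral_combine integrable_continuous_real
            continuous_on_subset[OF fh]) auto
    then show ?case using Suc by simp
  qed
  \<comment> \<open>On one interval the increment of \<open>G\<close> is the integral of \<open>h\<close>, so the error is the integral of
    \<open>(f \<xi> - f s) * h s\<close>, which the oscillation of \<open>f\<close> controls.\<close>
  have piece: "\<bar>f (\<xi> n j) * (G (p n (Suc j)) - G (p n j)) - integral {p n j..p n (Suc j)} (\<lambda>s. f s * h s)\<bar>
        \<le> e * C * (t / Suc n)"
    if j: "j < Suc n" and e: "\<And>s. s \<in> {p n j..p n (Suc j)} \<Longrightarrow> \<bar>f (\<xi> n j) - f s\<bar> \<le> e" for n j e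
  proof -
    let ?I = "{p n j..p n (Suc j)}"
    have le: "p n j \<le> p n (Suc j)" by (rule p_mono) simp
    have sub: "?I \<subseteq> {0..t}" using p_in[of n j] p_in(2)[of "Suc j" n] j by auto
    have "(h has_integral (G (p n (Suc j)) - G (p n j))) ?I"
      using le by (rule fundamental_theorem_of_calculus)
        (use sub G in \<open>auto simp flip: has_real_derivative_iff_has_vector_derivative
           intro!: DERIV_subset[OF _ sub]\<close>)
    from has_integral_mult_right[OF this, of "f (\<xi> n j)"]
    have "((\<lambda>s. f (\<xi> n j) * h s - f s * h s) has_integral
        (f (\<xi> n j) * (G (p n (Suc j)) - G (p n j)) - integral ?I (\<lambda>s. f s * h s))) ?I"
      by (intro has_integral_diff integrable_integral integrable_continuous_real
            continuous_on_subset[OF fh sub])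
    moreover have "norm (f (\<xi> n j) * h s - f s * h s) \<le> e * C" if "s \<in> ?I" for s
    proof -
      have "norm (f (\<xi> n j) * h s - f s * h s) = \<bar>f (\<xi> n j) - f s\<bar> * \<bar>h s\<bar>"
        by (simp add: abs_mult flip: left_diff_distrib)
      also have "\<dots> \<le> e * C"
        using e[OF that] C[of s] sub that by (intro mult_mono) auto
      finally show ?thesis .
    qed
    moreover have "0 \<le> e * C" using e[of "p n j"] le C0 by auto
    ultimately have "norm (f (\<xi> n j) * (G (p n (Suc j)) - G (p n j)) - integral ?I (\<lambda>s. f s * h s))
        \<le> e * C * measure lborel (cbox (p n j) (p n (Suc j)))"
      by (intro has_integral_bound[where f="\<lambda>s. f (\<xi> n j) * h s - f s * h s"]) auto
    then show ?thesis using t by (simp add: p_step)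
  qed
  have "\<exists>N. \<forall>n\<ge>N. norm ((\<Sum>j<Suc n. f (\<xi> n j) * (G (p n (Suc j)) - G (p n j)))
        - integral {0..t} (\<lambda>s. f s * h s)) < r" if r: "0 < r" for r
  proof -
    \<comment> \<open>The errors of all intervals add up to at most \<open>e * C * t = r / 2\<close>.\<close>
    define e where "e = r / (2 * C * t)"
    have e: "e > 0" unfolding e_def using r C0 t by auto
    have "uniformly_continuous_on {0..t} f"
      using f by (intro compact_uniformly_continuous) auto
    then obtain d where d: "d > 0" "\<And>x y. x \<in> {0..t} \<Longrightarrow> y \<in> {0..t} \<Longrightarrow> \<bar>y - x\<bar> < d \<Longrightarrow> \<bar>f y - f x\<bar> < e"
      unfolding uniformly_continuous_on_def dist_real_def using e by metis
    obtain N where N: "t / d < real N" using reals_Archimedean2 by blast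
    have "norm ((\<Sum>j<Suc n. f (\<xi> n j) * (G (p n (Suc j)) - G (p n j)))
        - integral {0..t} (\<lambda>s. f s * h s)) < r" if n: "N \<le> n" for n
    proof -
      have "t / d < real (Suc n)" using N n by linarith
      then have mesh: "t / real (Suc n) < d" using d(1) by (simp add: field_simps)
      have "norm ((\<Sum>j<Suc n. f (\<xi> n j) * (G (p n (Suc j)) - G (p n j))) - integral {0..t} (\<lambda>s. f s * h s))
         = norm (\<Sum>j<Suc n. f (\<xi> n j) * (G (p n (Suc j)) - G (p n j)) - integral {p n j..p n (Suc j)} (\<lambda>s. f s * h s))"
        using split[of "Suc n" n] by (simp add: pn sum_subtractf)
      also have "\<dots> \<le> (\<Sum>j<Suc n. e * C * (t / Suc n))"
      proof (rule sum_norm_le)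
        fix j assume "j \<in> {..<Suc n}"
        then have j: "j < Suc n" by simp
        have "\<bar>f (\<xi> n j) - f s\<bar> \<le> e" if "s \<in> {p n j..p n (Suc j)}" for s
        proof -
          have "\<xi> n j \<in> {p n j..p n (Suc j)}" using \<xi>[OF j] by (simp add: p_def)
          then show ?thesis
            using that p_in[of n j] p_in(2)[of "Suc j" n] j mesh p_step[of n j]
            by (intro less_imp_le d(2)) auto
        qed
        from piece[OF j this]
        show "norm (f (\<xi> n j) * (G (p n (Suc j)) - G (p n j)) - integral {p n j..p n (Suc j)} (\<lambda>s. f s * h s))
          \<le> e * C * (t / Suc n)" by simp
      qed
      also have "\<dots> = e * C * t" by (simp only: sum_constant card_lessThan) (simp add: field_simps)
      also have "\<dots> = r / 2" unfolding e_def using C0 t by simp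
      also have "\<dots> < r" using r by simp
      finally show ?thesis .
    qed
    then show ?thesis by blast
  qed
  then show ?thesis unfolding p_def by (rule LIMSEQ_I)
qed

lemma sum_parts_lessThan:
  fixes k w :: "nat \<Rightarrow> real"
  shows "(\<Sum>j<m. k j * (w (Suc j) - w j)) = k m * w m - k 0 * w 0 + (\<Sum>j<m. w (Suc j) * - (k (Suc j) - k j))"
  by (induction m) (simp_all add: algebra_simps)

text \<open>
  As \<open>K\<close> is continuously differentiable, the Wiener integral of \<open>K\<close> exists path by path: summation by parts moves the
  increments from the rough path \<open>w\<close> to \<open>K\<close>, and the boundary terms vanish as \<open>w 0 = 0\<close> and \<open>K t = 0\<close>.
\<close>
lemma wiener_sums_tendsto:
  fixes K h w :: "real \<Rightarrow> real"
  assumes t: "0 < t" and w: "continuous_on {0..t} w" "w 0 = 0" and h: "continuous_on {0..t} h"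
    and K: "\<And>s. s \<in> {0..t} \<Longrightarrow> (K has_real_derivative - h s) (at s within {0..t})" "K t = 0"
  shows "(\<lambda>n. \<Sum>j<Suc n. K (real j * (t / Suc n)) * (w (real (Suc j) * (t / Suc n)) - w (real j * (t / Suc n))))
           \<longlonglongrightarrow> integral {0..t} (\<lambda>s. w s * h s)"
proof -
  have "(\<Sum>j<Suc n. K (real j * (t / Suc n)) * (w (real (Suc j) * (t / Suc n)) - w (real j * (t / Suc n))))
      = (\<Sum>j<Suc n. w (real (Suc j) * (t / Suc n)) * - (K (real (Suc j) * (t / Suc n)) - K (real j * (t / Suc n))))" for n
    using sum_parts_lessThan[of "\<lambda>j. K (real j * (t / Suc n))" "\<lambda>j. w (real j * (t / Suc n))" "Suc n"] K(2) w(2)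
    by (simp del: sum.lessThan_Suc)
  moreover have "(\<lambda>n. \<Sum>j<Suc n. w (real (Suc j) * (t / Suc n)) * (- K (real (Suc j) * (t / Suc n)) - - K (real j * (t / Suc n))))
      \<longlonglongrightarrow> integral {0..t} (\<lambda>s. w s * h s)"
  proof (rule riemann_stieltjes_sums_tendsto[OF t w(1) h])
    show "((\<lambda>s. - K s) has_real_derivative h s) (at s within {0..t})" if "s \<in> {0..t}" for s
      using DERIV_minus[OF K(1)[OF that]] by simp
    show "real (Suc j) * (t / Suc n) \<in> {real j * (t / Suc n) .. real (Suc j) * (t / Suc n)}" for n j
      using t by (auto intro!: mult_right_mono divide_right_mono)
  qed
  ultimately show ?thesis by simp
qed

lemma (in prob_space) char_centred_normal:
  assumes X: "distributed M lborel X (\<lambda>x. ennreal (normal_density 0 s x))" and s: "0 < s"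
  shows "char (distr M borel X) u = of_real (exp (- (s * u)\<^sup>2 / 2))"
proof -
  define Z where "Z = (\<lambda>x. (X x - 0) / s)"
  have Z: "distributed M lborel Z (\<lambda>x. ennreal (std_normal_density x))"
    unfolding Z_def using X normal_standard_normal_convert[OF s] by blast
  have XZ: "X \<omega> = s * Z \<omega>" for \<omega> using s by (simp add: Z_def)
  have [measurable]: "X \<in> borel_measurable M" "Z \<in> borel_measurable M"
    using distributed_measurable[OF X] distributed_measurable[OF Z] by simp_all
  have "distr M borel Z = std_normal_distribution"
    using distributed_distr_eq_density[OF Z] by (simp cong: distr_cong)
  moreover have "char (distr M borel X) u = char (distr M borel Z) (s * u)"
    unfolding char_def by (simp add: integral_distr XZ mult_ac)
  ultimately show ?thesis by (simp add: char_std_normal_distribution)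
qed

text \<open>
  The identity on the normal distribution itself is a normally distributed random variable.
\<close>
lemma char_centred_normal_density:
  assumes "0 < s"
  shows "char (density lborel (\<lambda>x. ennreal (normal_density 0 s x))) u = of_real (exp (- (s * u)\<^sup>2 / 2))"
proof -
  let ?N = "density lborel (\<lambda>x. ennreal (normal_density 0 s x))"
  interpret N: prob_space ?N using assms by (rule prob_space_normal_density)
  have "distributed ?N lborel (\<lambda>x. x) (\<lambda>x. ennreal (normal_density 0 s x))"
    by (auto simp: distributed_def intro!: distr_id2)
  from N.char_centred_normal[OF this assms] show ?thesis
    by (simp add: distr_id2)
qed

text \<open>
  This is the Wiener isometry together with the Gaussian law of the integral. The sums are combinations
  of independent normal increments, so their characteristic functions are explicit and converge to that
  of a normal law; by dominated convergence they also converge to that of \<open>Y\<close>.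
\<close>
lemma (in prob_space) wiener_sums_limit_normal:
  fixes K :: "real \<Rightarrow> real" and Y :: "'a \<Rightarrow> real"
  assumes W: "standard_brownian_motion M W" and t: "0 < t"
    and K: "continuous_on {0..t} K" and v: "0 < integral {0..t} (\<lambda>s. (K s)\<^sup>2)"
    and Y[measurable]: "Y \<in> borel_measurable M"
    and lim: "AE \<omega> in M. (\<lambda>n. \<Sum>j<Suc n. K (real j * (t / Suc n)) *
        (W (real (Suc j) * (t / Suc n)) \<omega> - W (real j * (t / Suc n)) \<omega>)) \<longlonglongrightarrow> Y \<omega>"
  shows "distributed M lborel Y (\<lambda>x. ennreal (normal_density 0 (sqrt (integral {0..t} (\<lambda>s. (K s)\<^sup>2))) x))"
proof -
  define v where "v = integral {0..t} (\<lambda>s. (K s)\<^sup>2)"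
  define p where "p = (\<lambda>n j. real j * (t / Suc n))"
  define X where "X = (\<lambda>n j \<omega>. W (p n (Suc j)) \<omega> - W (p n j) \<omega>)"
  define S where "S = (\<lambda>n \<omega>. \<Sum>j<Suc n. K (p n j) * X n j \<omega>)"
  have p_step: "p n (Suc j) = p n j + t / Suc n" for n j by (simp add: p_def algebra_simps add_divide_distrib)
  have p_less: "p n j < p n (Suc j)" for n j using t by (simp add: p_step)
  have p_nonneg: "0 \<le> p n j" for n j using t by (simp add: p_def)
  have [measurable]: "W (p n j) \<in> borel_measurable M" for n j
    using W p_nonneg by (auto simp: standard_brownian_motion_def)
  have [measurable]: "X n j \<in> borel_measurable M" "S n \<in> borel_measurable M" for n j
    unfolding X_def S_def by measurable
  have indep: "indep_vars (\<lambda>_. borel) (X n) {..<Suc n}" for n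
    using W p_nonneg p_less unfolding standard_brownian_motion_def independent_increments_def X_def
    by (meson less_imp_le)
  have X_char: "char (distr M borel (X n j)) u = of_real (exp (- (t / Suc n * u\<^sup>2) / 2))" for n j u
  proof -
    have "distributed M lborel (X n j) (\<lambda>x. ennreal (normal_density 0 (sqrt (p n (Suc j) - p n j)) x))"
      using W p_nonneg p_less unfolding standard_brownian_motion_def X_def by blast
    then show ?thesis
      using t by (subst char_centred_normal[where s="sqrt (t / Suc n)"]) (simp_all add: p_step power_mult_distrib)
  qed
  \<comment> \<open>Independence turns the characteristic function of the sum into a product of Gaussian exponentials,
    whose exponents add up to a Riemann sum for the variance.\<close>
  have S_char: "char (distr M borel (S n)) u = of_real (exp (- u\<^sup>2 / 2 * (\<Sum>j<Suc n. (K (p n j))\<^sup>2 * (p n (Suc j) - p n j))))"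
    for n u
  proof -
    have "indep_vars (\<lambda>_. borel) (\<lambda>j \<omega>. K (p n j) * X n j \<omega>) {..<Suc n}"
      by (rule indep_vars_compose2[OF indep]) simp
    then have "char (distr M borel (S n)) u = (\<Prod>j<Suc n. char (distr M borel (\<lambda>\<omega>. K (p n j) * X n j \<omega>)) u)"
      unfolding S_def by (rule char_distr_sum)
    also have "\<dots> = (\<Prod>j<Suc n. char (distr M borel (X n j)) (K (p n j) * u))"
      unfolding char_def by (intro prod.cong refl) (simp add: integral_distr mult_ac)
    also have "\<dots> = of_real (exp (\<Sum>j<Suc n. - (t / Suc n * (K (p n j) * u)\<^sup>2) / 2))"
      unfolding X_char by (simp only: of_real_prod exp_sum finite_lessThan)
    also have "(\<Sum>j<Suc n. - (t / Suc n * (K (p n j) * u)\<^sup>2) / 2)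
        = - u\<^sup>2 / 2 * (\<Sum>j<Suc n. (K (p n j))\<^sup>2 * (p n (Suc j) - p n j))"
      unfolding sum_distrib_left by (intro sum.cong) (simp_all add: p_step power_mult_distrib mult_ac)
    finally show ?thesis .
  qed
  have "(\<lambda>n. \<Sum>j<Suc n. (K (p n j))\<^sup>2 * (p n (Suc j) - p n j)) \<longlonglongrightarrow> integral {0..t} (\<lambda>s. (K s)\<^sup>2 * 1)"
    unfolding p_def using t
    by (intro riemann_stieltjes_sums_tendsto[where G="\<lambda>s. s" and \<xi>="\<lambda>n j. real j * (t / Suc n)"])
      (auto intro!: continuous_intros K derivative_eq_intros mult_right_mono divide_right_mono)
  then have var: "(\<lambda>n. \<Sum>j<Suc n. (K (p n j))\<^sup>2 * (p n (Suc j) - p n j)) \<longlonglongrightarrow> v"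
    by (simp add: v_def)
  have lim': "AE \<omega> in M. (\<lambda>n. S n \<omega>) \<longlonglongrightarrow> Y \<omega>"
    using lim unfolding S_def X_def p_def .
  have "char (distr M borel Y) u = of_real (exp (- (sqrt v * u)\<^sup>2 / 2))" for u
  proof (rule LIMSEQ_unique)
    have "(\<lambda>n. \<integral>\<omega>. iexp (u * S n \<omega>) \<partial>M) \<longlonglongrightarrow> (\<integral>\<omega>. iexp (u * Y \<omega>) \<partial>M)"
    proof (rule integral_dominated_convergence[where w="\<lambda>_. 1"])
      show "AE \<omega> in M. (\<lambda>n. iexp (u * S n \<omega>)) \<longlonglongrightarrow> iexp (u * Y \<omega>)"
        using lim' by eventually_elim (intro tendsto_intros)
    qed auto
    then show "(\<lambda>n. char (distr M borel (S n)) u) \<longlonglongrightarrow> char (distr M borel Y) u"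
      by (simp add: char_def integral_distr)
    have "(sqrt v * u)\<^sup>2 = u\<^sup>2 * v" using assms(4) by (simp add: v_def power_mult_distrib)
    then have "(\<lambda>n. exp (- u\<^sup>2 / 2 * (\<Sum>j<Suc n. (K (p n j))\<^sup>2 * (p n (Suc j) - p n j))))
        \<longlonglongrightarrow> exp (- (sqrt v * u)\<^sup>2 / 2)"
      using tendsto_exp[OF tendsto_mult_left[OF var, of "- u\<^sup>2 / 2"]] by simp
    then show "(\<lambda>n. char (distr M borel (S n)) u) \<longlonglongrightarrow> of_real (exp (- (sqrt v * u)\<^sup>2 / 2))"
      unfolding S_char by (rule tendsto_of_real)
  qed
  then have "char (distr M borel Y) = char (density lborel (\<lambda>x. ennreal (normal_density 0 (sqrt v) x)))"
    using assms(4) by (intro ext) (simp add: char_centred_normal_density v_def)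
  moreover have "real_distribution (density lborel (\<lambda>x. ennreal (normal_density 0 (sqrt v) x)))"
    using prob_space_normal_density[of "sqrt v" 0] assms(4)
    by (simp add: real_distribution_def real_distribution_axioms_def v_def)
  moreover have "real_distribution (distr M borel Y)" by (rule real_distribution_distr) simp
  ultimately have "distr M borel Y = density lborel (\<lambda>x. ennreal (normal_density 0 (sqrt v) x))"
    by (intro Levy_uniqueness)
  then show ?thesis
    unfolding distributed_def v_def[symmetric] by (simp cong: distr_cong)
qed

section \<open>The integrated Ornstein-Uhlenbeck process\<close>

text \<open>
  The primitive \<open>B\<close> of a path satisfies the linear equation \<open>B' = a\<^sub>0 + \<theta> * \<mu> * s - \<theta> * B + \<sigma> * w\<close>.
  The integrating factor \<open>exp (\<theta> * s)\<close>, scaled to be 1 at \<open>s = t\<close>, solves it with an ordinary integral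
  of the path \<open>w\<close> instead of a stochastic integral.
\<close>
lemma ornstein_uhlenbeck_path_integral:
  fixes b w :: "real \<Rightarrow> real"
  assumes t: "0 < t" and \<theta>: "0 < \<theta>" and b: "continuous_on {0..t} b" and w: "continuous_on {0..t} w"
    and eq: "\<And>s. s \<in> {0..t} \<Longrightarrow> b s = a\<^sub>0 + integral {0..s} (\<lambda>r. \<theta> * (\<mu> - b r)) + \<sigma> * w s"
  shows "integral {0..t} b =
    t * transport_speed \<theta> \<mu> a\<^sub>0 t + integral {0..t} (\<lambda>s. w s * (\<sigma> * exp (- \<theta> * (t - s))))"
proof -
  define B where "B = (\<lambda>s. integral {0..s} b)"
  \<comment> \<open>A particular solution of the noiseless equation \<open>c' = a\<^sub>0 + \<theta> * \<mu> * s - \<theta> * c\<close>; subtracting it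
    leaves a linear equation for \<open>B - c\<close> driven by \<open>w\<close> alone.\<close>
  define c where "c = (\<lambda>s. a\<^sub>0 / \<theta> + \<mu> * s - \<mu> / \<theta>)"
  have B': "(B has_real_derivative b s) (at s within {0..t})" if "s \<in> {0..t}" for s
    unfolding B_def using integral_has_real_derivative[OF b that] .
  have lin: "b s = a\<^sub>0 + \<theta> * \<mu> * s - \<theta> * B s + \<sigma> * w s" if s: "s \<in> {0..t}" for s
  proof -
    have "(b has_integral B s) {0..s}"
      unfolding B_def using s
      by (intro integrable_integral integrable_continuous_real continuous_on_subset[OF b]) auto
    then have "((\<lambda>r. \<theta> * (\<mu> - b r)) has_integral \<theta> * (s * \<mu> - B s)) {0..s}"
      using has_integral_const_real[of \<mu> 0 s] s
      by (intro has_integral_mult_right has_integral_diff) auto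
    then have "integral {0..s} (\<lambda>r. \<theta> * (\<mu> - b r)) = \<theta> * (s * \<mu> - B s)"
      by (rule integral_unique)
    then show ?thesis using eq[OF s] by (simp add: algebra_simps)
  qed
  have "((\<lambda>s. w s * (\<sigma> * exp (- \<theta> * (t - s)))) has_integral
      exp (- \<theta> * (t - t)) * (B t - c t) - exp (- \<theta> * (t - 0)) * (B 0 - c 0)) {0..t}"
  proof (rule fundamental_theorem_of_calculus)
    fix s assume s: "s \<in> {0..t}"
    have "((\<lambda>s. exp (- \<theta> * (t - s)) * (B s - c s)) has_real_derivative
        exp (- \<theta> * (t - s)) * \<theta> * (B s - c s) + exp (- \<theta> * (t - s)) * (b s - \<mu>)) (at s within {0..t})"
      unfolding c_def by (rule derivative_eq_intros B'[OF s] refl | simp)+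
    also have "exp (- \<theta> * (t - s)) * \<theta> * (B s - c s) + exp (- \<theta> * (t - s)) * (b s - \<mu>)
        = w s * (\<sigma> * exp (- \<theta> * (t - s)))"
      using \<theta> by (simp add: lin[OF s] c_def field_simps)
    finally show "((\<lambda>s. exp (- \<theta> * (t - s)) * (B s - c s)) has_vector_derivative
        w s * (\<sigma> * exp (- \<theta> * (t - s)))) (at s within {0..t})"
      by (simp add: has_real_derivative_iff_has_vector_derivative)
  qed (use t in simp)
  then have "integral {0..t} (\<lambda>s. w s * (\<sigma> * exp (- \<theta> * (t - s))))
      = B t - c t + exp (- \<theta> * t) * c 0"
    by (simp add: integral_unique B_def)
  moreover have "c t - exp (- \<theta> * t) * c 0 = t * transport_speed \<theta> \<mu> a\<^sub>0 t"
    using t \<theta> by (simp add: c_def transport_speed_def field_simps)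
  ultimately show ?thesis by (simp add: B_def)
qed

text \<open>
  An antiderivative of the integrand is \<open>s \<mapsto> - diffusion_coeff \<theta> \<sigma> (t - s)\<close>, which vanishes at
  \<open>s = t\<close>.
\<close>
lemma diffusion_coeff_eq_integral:
  assumes "0 < \<theta>" "0 < t"
  shows "integral {0..t} (\<lambda>s. (\<sigma> * (1 - exp (- \<theta> * (t - s))) / \<theta>)\<^sup>2) = diffusion_coeff \<theta> \<sigma> t"
proof -
  have "((\<lambda>s. (\<sigma> * (1 - exp (- \<theta> * (t - s))) / \<theta>)\<^sup>2) has_integral
      (- diffusion_coeff \<theta> \<sigma> (t - t)) - (- diffusion_coeff \<theta> \<sigma> (t - 0))) {0..t}"
  proof (rule fundamental_theorem_of_calculus)
    fix s
    have "((\<lambda>s. - diffusion_coeff \<theta> \<sigma> (t - s)) has_real_derivative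
       - (\<sigma>\<^sup>2 / \<theta> ^ 3 * (- \<theta> + 2 * (\<theta> * exp (- \<theta> * (t - s))) - 1 / 2 * (2 * \<theta> * exp (- 2 * \<theta> * (t - s))))))
       (at s within {0..t})"
      unfolding diffusion_coeff_def by (rule derivative_eq_intros refl | simp)+
    also have "- (\<sigma>\<^sup>2 / \<theta> ^ 3 * (- \<theta> + 2 * (\<theta> * exp (- \<theta> * (t - s))) - 1 / 2 * (2 * \<theta> * exp (- 2 * \<theta> * (t - s)))))
      = (\<sigma> * (1 - exp (- \<theta> * (t - s))) / \<theta>)\<^sup>2"
    proof -
      define E where "E = exp (- \<theta> * (t - s))"
      have "exp (- 2 * \<theta> * (t - s)) = E\<^sup>2"
        by (simp add: E_def power2_eq_square flip: exp_add)
      then show ?thesis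
        using assms(1) unfolding E_def[symmetric]
        by (simp add: field_simps power2_eq_square power3_eq_cube)
    qed
    finally show "((\<lambda>s. - diffusion_coeff \<theta> \<sigma> (t - s)) has_vector_derivative
        (\<sigma> * (1 - exp (- \<theta> * (t - s))) / \<theta>)\<^sup>2) (at s within {0..t})"
      by (simp add: has_real_derivative_iff_has_vector_derivative)
  qed (use assms in simp)
  then show ?thesis by (simp add: integral_unique diffusion_coeff_def)
qed

lemma diffusion_coeff_pos:
  assumes "0 < \<theta>" "0 < \<sigma>" "0 < t"
  shows "0 < diffusion_coeff \<theta> \<sigma> t"
proof -
  let ?f = "\<lambda>s. (\<sigma> * (1 - exp (- \<theta> * (t - s))) / \<theta>)\<^sup>2"
  have cont: "continuous_on {0..t} ?f" using assms by (intro continuous_intros) auto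
  have "integral {0..t} ?f \<noteq> 0"
  proof
    assume "integral {0..t} ?f = 0"
    then have "?f 0 = 0"
      using integral_eq_0_iff[OF cont] assms by auto
    then show False using assms by simp
  qed
  moreover have "0 \<le> integral {0..t} ?f"
    by (intro integral_nonneg integrable_continuous_real cont) simp
  ultimately show ?thesis using diffusion_coeff_eq_integral[of \<theta> t \<sigma>] assms by simp
qed

lemma gaussian_pdf_eq_normal_density:
  "0 < v \<Longrightarrow> gaussian_pdf v m = normal_density m (sqrt v)"
  by (simp add: fun_eq_iff gaussian_pdf_def normal_density_def)

text \<open>
  The pathwise integral is a limit of measurable sums only almost surely, so over an incomplete \<open>M\<close> it
  may fail to be measurable. The limit of the sums, shifted by the mean, is a measurable version
  of it, for which the law is stated.
\<close>
lemma integrated_ornstein_uhlenbeck_normal: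
  assumes M: "prob_space M" and \<theta>: "\<theta> > 0" and \<sigma>: "\<sigma> > 0"
    and W: "standard_brownian_motion M W"
    and a: "ornstein_uhlenbeck M W T \<theta> \<mu> \<sigma> a\<^sub>0 a"
    and t: "t \<in> {0<..T}"
  obtains Y where "AE \<omega> in M. Y \<omega> = integral {0..t} (\<lambda>s. a s \<omega>)"
    and "distributed M lborel Y
      (\<lambda>y. ennreal (gaussian_pdf (diffusion_coeff \<theta> \<sigma> t) (t * transport_speed \<theta> \<mu> a\<^sub>0 t) y))"
proof -
  interpret prob_space M by (rule M)
  \<comment> \<open>Chosen so that \<open>K t = 0\<close> and \<open>- K'\<close> is the kernel in \<open>ornstein_uhlenbeck_path_integral\<close>.\<close>
  define K where "K = (\<lambda>s. \<sigma> * (1 - exp (- \<theta> * (t - s))) / \<theta>)"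
  define S where "S = (\<lambda>n \<omega>. \<Sum>j<Suc n. K (real j * (t / Suc n)) *
        (W (real (Suc j) * (t / Suc n)) \<omega> - W (real j * (t / Suc n)) \<omega>))"
  define m where "m = t * transport_speed \<theta> \<mu> a\<^sub>0 t"
  define Y where "Y = (\<lambda>\<omega>. lim (\<lambda>n. S n \<omega>))"
  have t0: "0 < t" using t by simp
  have "W (real j * (t / Suc n)) \<in> borel_measurable M" for j n
    using W t0 by (auto simp: standard_brownian_motion_def)
  then have [measurable]: "S n \<in> borel_measurable M" for n
    unfolding S_def by (intro borel_measurable_sum borel_measurable_times borel_measurable_diff borel_measurable_const)
  have Y_meas[measurable]: "Y \<in> borel_measurable M" unfolding Y_def by measurable
  have "AE \<omega> in M. continuous_on {0..} (\<lambda>t. W t \<omega>)"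
    using W by (simp add: standard_brownian_motion_def)
  moreover have "AE \<omega> in M. continuous_on {0..T} (\<lambda>t. a t \<omega>) \<and>
        (\<forall>t\<in>{0..T}. a t \<omega> =
           a\<^sub>0 + integral {0..t} (\<lambda>s. \<theta> * (\<mu> - a s \<omega>)) + \<sigma> * (W t \<omega> - W 0 \<omega>))"
    using a by (simp add: ornstein_uhlenbeck_def)
  ultimately have lim: "AE \<omega> in M. (\<lambda>n. S n \<omega>) \<longlonglongrightarrow> integral {0..t} (\<lambda>s. a s \<omega>) - m"
  proof eventually_elim
    case (elim \<omega>)
    define w where "w = (\<lambda>s. W s \<omega> - W 0 \<omega>)"
    have w: "continuous_on {0..t} w" "w 0 = 0"
      unfolding w_def by (auto intro!: continuous_intros continuous_on_subset[OF elim(1)])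
    have "(\<lambda>n. \<Sum>j<Suc n. K (real j * (t / Suc n)) * (w (real (Suc j) * (t / Suc n)) - w (real j * (t / Suc n))))
           \<longlonglongrightarrow> integral {0..t} (\<lambda>s. w s * (\<sigma> * exp (- \<theta> * (t - s))))"
    proof (rule wiener_sums_tendsto[OF t0 w])
      show "(K has_real_derivative - (\<sigma> * exp (- \<theta> * (t - s)))) (at s within {0..t})" for s
        unfolding K_def using \<theta> by (auto intro!: derivative_eq_intros)
    qed (auto intro!: continuous_intros simp: K_def)
    moreover have "integral {0..t} (\<lambda>s. a s \<omega>) = m + integral {0..t} (\<lambda>s. w s * (\<sigma> * exp (- \<theta> * (t - s))))"
      unfolding m_def
    proof (rule ornstein_uhlenbeck_path_integral[OF t0 \<theta> _ w(1)])
      show "continuous_on {0..t} (\<lambda>s. a s \<omega>)"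
        using t by (intro continuous_on_subset[OF conjunct1[OF elim(2)]]) auto
      show "a s \<omega> = a\<^sub>0 + integral {0..s} (\<lambda>r. \<theta> * (\<mu> - a r \<omega>)) + \<sigma> * w s" if "s \<in> {0..t}" for s
        unfolding w_def by (rule bspec[OF conjunct2[OF elim(2)]]) (use that t in auto)
    qed
    ultimately show ?case by (simp add: S_def w_def del: sum.lessThan_Suc)
  qed
  have Y_eq: "AE \<omega> in M. Y \<omega> = integral {0..t} (\<lambda>s. a s \<omega>) - m"
    using lim by eventually_elim (simp add: Y_def limI)
  have limY: "AE \<omega> in M. (\<lambda>n. S n \<omega>) \<longlonglongrightarrow> Y \<omega>"
    using lim Y_eq by eventually_elim simp
  have var: "integral {0..t} (\<lambda>s. (K s)\<^sup>2) = diffusion_coeff \<theta> \<sigma> t"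
    unfolding K_def by (rule diffusion_coeff_eq_integral[OF \<theta> t0])
  have pos: "0 < diffusion_coeff \<theta> \<sigma> t" by (rule diffusion_coeff_pos[OF \<theta> \<sigma> t0])
  have "continuous_on {0..t} K" unfolding K_def using \<theta> by (intro continuous_intros) auto
  from wiener_sums_limit_normal[OF W t0 this _ Y_meas limY[unfolded S_def]] pos
  have "distributed M lborel Y (\<lambda>x. ennreal (normal_density 0 (sqrt (diffusion_coeff \<theta> \<sigma> t)) x))"
    by (simp add: var)
  from normal_density_affine[OF this, of 1 m] pos
  have "distributed M lborel (\<lambda>\<omega>. m + Y \<omega>) (\<lambda>x. ennreal (gaussian_pdf (diffusion_coeff \<theta> \<sigma> t) m x))"
    by (simp add: gaussian_pdf_eq_normal_density)
  moreover have "AE \<omega> in M. m + Y \<omega> = integral {0..t} (\<lambda>s. a s \<omega>)"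
    using Y_eq by eventually_elim simp
  ultimately show ?thesis
    unfolding m_def by (rule that[rotated])
qed

section \<open>Moments of the solution\<close>

lemma gaussian_pdf_convolution:
  "(\<integral>y. g (x - y) * gaussian_pdf v m y \<partial>lborel) = fun_convolution (gaussian_pdf v 0) g (x - m)"
proof -
  have "(\<integral>y. g (x - y) * gaussian_pdf v m y \<partial>lborel)
      = (\<integral>y. g (x - (m + 1 * y)) * gaussian_pdf v m (m + 1 * y) \<partial>lborel)"
    using lborel_integral_real_affine[of 1 "\<lambda>y. g (x - y) * gaussian_pdf v m y" m] by simp
  then show ?thesis
    by (simp add: fun_convolution_def gaussian_pdf_def algebra_simps)
qed

theorem theorem2p2:
  fixes M :: "'a measure"
    and W a :: "real \<Rightarrow> 'a \<Rightarrow> real"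
    and u :: "real \<Rightarrow> real \<Rightarrow> 'a \<Rightarrow> real"
    and g :: "real \<Rightarrow> real"
    and T \<theta> \<mu> \<sigma> a\<^sub>0 :: real
  assumes "prob_space M"
    and "T > 0" and "\<theta> > 0" and "\<sigma> > 0"
    and "standard_brownian_motion M W"
    and "ornstein_uhlenbeck M W T \<theta> \<mu> \<sigma> a\<^sub>0 a"
    and "g \<in> borel_measurable borel"
    and "random_advection_solution M T a g u"
  shows "\<forall>x. \<forall>t\<in>{0<..T}.
    (\<forall>k::nat. k \<ge> 1 \<longrightarrow>
       integrable lborel
         (\<lambda>y. g (x - y) ^ k * gaussian_pdf (diffusion_coeff \<theta> \<sigma> t) (t * transport_speed \<theta> \<mu> a\<^sub>0 t) y) \<longrightarrow>
       integrable M (\<lambda>\<omega>. u x t \<omega> ^ k)) \<and>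
    prob_space.expectation M (u x t) =
      (\<integral>y. g (x - y) * gaussian_pdf (diffusion_coeff \<theta> \<sigma> t) (t * transport_speed \<theta> \<mu> a\<^sub>0 t) y \<partial>lborel) \<and>
    (\<integral>y. g (x - y) * gaussian_pdf (diffusion_coeff \<theta> \<sigma> t) (t * transport_speed \<theta> \<mu> a\<^sub>0 t) y \<partial>lborel) =
      fun_convolution (gaussian_pdf (diffusion_coeff \<theta> \<sigma> t) 0) g (x - t * transport_speed \<theta> \<mu> a\<^sub>0 t)"
proof (intro allI ballI)
  fix x t :: real
  assume t: "t \<in> {0<..T}"
  let ?\<phi> = "gaussian_pdf (diffusion_coeff \<theta> \<sigma> t) (t * transport_speed \<theta> \<mu> a\<^sub>0 t)"
  note [measurable] = assms(7)
  obtain Y where Y: "AE \<omega> in M. Y \<omega> = integral {0..t} (\<lambda>s. a s \<omega>)"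
    and dist: "distributed M lborel Y (\<lambda>y. ennreal (?\<phi> y))"
    using integrated_ornstein_uhlenbeck_normal[OF assms(1,3-6) t] by blast
  have [measurable]: "Y \<in> borel_measurable M" using distributed_measurable[OF dist] by simp
  have [measurable]: "u x t \<in> borel_measurable M"
    using assms(8) t by (simp add: random_advection_solution_def)
  have \<phi>: "0 \<le> ?\<phi> y" for y
    using diffusion_coeff_pos[of \<theta> \<sigma> t] assms(3,4) t by (simp add: gaussian_pdf_def)
  have "AE \<omega> in M. continuous_on {0..T} (\<lambda>s. a s \<omega>)"
    using assms(6) by (auto simp: ornstein_uhlenbeck_def)
  moreover have "AE \<omega> in M. advection_solution T (\<lambda>t. a t \<omega>) g (\<lambda>x t. u x t \<omega>)"
    using assms(8) by (simp add: random_advection_solution_def)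
  ultimately have u: "AE \<omega> in M. u x t \<omega> = g (x - Y \<omega>)"
    using Y
  proof eventually_elim
    case (elim \<omega>)
    from elim(2) have "u x t \<omega> = g (x - integral {0..t} (\<lambda>s. a s \<omega>))"
      unfolding advection_solution_def
    proof
      assume "classical_advection_solution T (\<lambda>t. a t \<omega>) g (\<lambda>x t. u x t \<omega>)"
      from classical_advection_solution_imp_transported[OF elim(1) this t] show ?thesis .
    next
      assume "transported_profile T (\<lambda>t. a t \<omega>) g (\<lambda>x t. u x t \<omega>)"
      then show ?thesis using t by (simp add: transported_profile_def)
    qed
    then show ?case by (simp add: elim(3))
  qed
  have moments: "integrable M (\<lambda>\<omega>. u x t \<omega> ^ k)"
    if "integrable lborel (\<lambda>y. g (x - y) ^ k * ?\<phi> y)" for k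
  proof -
    have "integrable M (\<lambda>\<omega>. g (x - Y \<omega>) ^ k)"
      using distributed_integrable[OF dist, of "\<lambda>y. g (x - y) ^ k"] that \<phi> by (simp add: mult.commute)
    moreover have "AE \<omega> in M. g (x - Y \<omega>) ^ k = u x t \<omega> ^ k"
      using u by eventually_elim simp
    ultimately show ?thesis by (subst (asm) integrable_cong_AE[where g="\<lambda>\<omega>. u x t \<omega> ^ k"]) auto
  qed
  have mean: "integral\<^sup>L M (u x t) = (\<integral>y. g (x - y) * ?\<phi> y \<partial>lborel)"
  proof -
    have "integral\<^sup>L M (u x t) = (\<integral>\<omega>. g (x - Y \<omega>) \<partial>M)"
      using u by (intro integral_cong_AE) auto
    also have "\<dots> = (\<integral>y. ?\<phi> y * g (x - y) \<partial>lborel)"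
      using distributed_integral[OF dist, of "\<lambda>y. g (x - y)"] \<phi> by simp
    finally show ?thesis by (simp add: mult.commute)
  qed
  show "(\<forall>k::nat. k \<ge> 1 \<longrightarrow> integrable lborel (\<lambda>y. g (x - y) ^ k * ?\<phi> y) \<longrightarrow>
       integrable M (\<lambda>\<omega>. u x t \<omega> ^ k)) \<and>
    prob_space.expectation M (u x t) = (\<integral>y. g (x - y) * ?\<phi> y \<partial>lborel) \<and>
    (\<integral>y. g (x - y) * ?\<phi> y \<partial>lborel) =
      fun_convolution (gaussian_pdf (diffusion_coeff \<theta> \<sigma> t) 0) g (x - t * transport_speed \<theta> \<mu> a\<^sub>0 t)"
    using moments mean gaussian_pdf_convolution by blast
qed

end
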